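(* Let $n\ge 0$ be an integer and $q$ a prime power, and let $B_n(q)$ be the poset of all linear subspaces of $\mathbb{F}_q^n$ ordered by inclusion. In the ruler game on $B_n(q)$, the Grundy value of a subspace $W\in B_n(q)$ depends only on $d=\dim W$; it equals the Grundy value of $\mathbb{F}_q^d$ in the ruler game on $B_d(q)$, denoted $g_q(d)$. Moreover: (i) if $q$ is even, then $g_q(d)=h(d+1)=2^{v_2(d+1)}$, where $v_2(x)$ is the exponent of the largest power of $2$ dividing $x$; (ii) if $q$ is odd, then $g_q(d)=(d \bmod 3)+1$, where $d\bmod 3\in\{0,1,2\}$ is the remainder of $d$ upon division by $3$.
   Context: Coin-turning games: let $X$ be a finite poset and $\mathcal{T}$ a family of nonempty subsets of $X$, each having a maximum element. In the game $\mathcal{G}(X,\mathcal{T})$ a position is a subset $H\subseteq X$ (the heads-up coins); a move from $H$ chooses $T\in\mathcal{T}$ with $\max T\in H$ and replaces $H$ by the symmetric difference $H\,\triangle\,T$; a player unable to move loses (normal play). The Grundy value $g(x)$ of $x\in X$ is the Sprague–Grundy value of the position $\{x\}$; equivalently $g(x)=\operatorname{mex}\{\bigoplus_{t\in T\setminus\{x\}}g(t) : T\in\mathcal{T},\ \max T=x\}$, where $\oplus$ is nim-sum (bitwise XOR) and $\operatorname{mex}(S)$ is the least nonnegative integer not in $S$. The ruler on $X$ is the game $\mathcal{G}(X,\mathcal{I})$ where $\mathcal{I}$ is the set of all closed intervals $[a,b]=\{t\in X: a\le t\le b\}$ with $a\le b$ in $X$. *)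

theory Defs
  imports
    "HOL-Library.Cardinality"
    "HOL-Library.Multiset"
    "HOL-Library.Function_Algebras"
    "HOL-Number_Theory.Prime_Powers"
begin

definition mex :: "nat set \<Rightarrow> nat" where
  "mex S = (LEAST n. n \<notin> S)"

text \<open>
  A game is given by its move relation: \<open>(p', p) \<in> M\<close> means that there is a move from \<open>p\<close>
  to \<open>p'\<close>. The recursion is meaningful when \<open>M\<close> is well-founded.
\<close>

definition sprague_grundy :: "('p \<times> 'p) set \<Rightarrow> 'p \<Rightarrow> nat" where
  "sprague_grundy M = wfrec M (\<lambda>g p. mex (g ` {p'. (p', p) \<in> M}))"

lemma sprague_grundy_unfold:
  assumes "wf M"
  shows "sprague_grundy M p = mex (sprague_grundy M ` {p'. (p', p) \<in> M})"
proof -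
  have "sprague_grundy M p = mex (cut (sprague_grundy M) M p ` {p'. (p', p) \<in> M})"
    unfolding sprague_grundy_def by (subst wfrec[OF assms]) (rule refl)
  also have "cut (sprague_grundy M) M p ` {p'. (p', p) \<in> M}
      = sprague_grundy M ` {p'. (p', p) \<in> M}"
    by (intro image_cong refl) (simp add: cut_apply)
  finally show ?thesis .
qed

text \<open>Posets are subsets \<open>X\<close> of an ordered type with the induced order.\<close>

definition coin_moves :: "'a::order set \<Rightarrow> 'a set set \<Rightarrow> ('a set \<times> 'a set) set" where
  "coin_moves X \<T> =
    {(H', H). H \<subseteq> X \<and>
       (\<exists>T\<in>\<T>. \<exists>m. m \<in> T \<and> (\<forall>t\<in>T. t \<le> m) \<and> m \<in> H \<and> H' = sym_diff H T)}"

definition coin_grundy :: "'a::order set \<Rightarrow> 'a set set \<Rightarrow> 'a \<Rightarrow> nat" where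
  "coin_grundy X \<T> x = sprague_grundy (coin_moves X \<T>) {x}"

definition closed_intervals :: "'a::order set \<Rightarrow> 'a set set" where
  "closed_intervals X = {{t \<in> X. a \<le> t \<and> t \<le> b} | a b. a \<in> X \<and> b \<in> X \<and> a \<le> b}"

definition ruler_grundy :: "'a::order set \<Rightarrow> 'a \<Rightarrow> nat" where
  "ruler_grundy X x = coin_grundy X (closed_intervals X) x"

lemma wf_coin_moves:
  fixes X :: "'a::order set"
  assumes fin: "finite X" and sub: "\<And>T. T \<in> \<T> \<Longrightarrow> T \<subseteq> X"
  shows "wf (coin_moves X \<T>)"
proof -
  define r where "r = {(a, b). a \<in> X \<and> b \<in> X \<and> a < b}"
  have "finite r"
    by (rule finite_subset[of _ "X \<times> X"]) (auto simp: r_def fin)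
  moreover have "acyclic r"
  proof -
    have "trans r" by (auto simp: r_def trans_def)
    then show ?thesis by (auto simp: acyclic_def r_def)
  qed
  ultimately have "wf r" by (rule finite_acyclic_wf)
  then have "wf (inv_image (mult r) mset_set)"
    by (intro wf_inv_image wf_mult)
  moreover have "coin_moves X \<T> \<subseteq> inv_image (mult r) mset_set"
  proof clarify
    fix H' H assume "(H', H) \<in> coin_moves X \<T>"
    then obtain T m where H: "H \<subseteq> X" and T: "T \<in> \<T>"
      and m: "m \<in> T" "\<And>t. t \<in> T \<Longrightarrow> t \<le> m" "m \<in> H" and H': "H' = sym_diff H T"
      unfolding coin_moves_def by blast
    have TX: "T \<subseteq> X" using sub T by blast
    have finH: "finite H" and finT: "finite T"
      using H TX fin by (auto intro: finite_subset)
    have "mset_set H = mset_set ((H - T) \<union> (H \<inter> T))"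
      by (rule arg_cong[where f = mset_set]) blast
    also have "\<dots> = mset_set (H - T) + mset_set (H \<inter> T)"
      using finH by (intro mset_set_Union) auto
    finally have 1: "mset_set H = mset_set (H - T) + mset_set (H \<inter> T)" .
    have 2: "mset_set H' = mset_set (H - T) + mset_set (T - H)"
      unfolding H' using finH finT by (intro mset_set_Union) auto
    have "(mset_set (H - T) + mset_set (T - H), mset_set (H - T) + mset_set (H \<inter> T)) \<in> mult r"
    proof (rule one_step_implies_mult)
      show "mset_set (H \<inter> T) \<noteq> {#}"
        using finH m by (auto simp: mset_set_empty_iff)
      show "\<forall>k\<in>#mset_set (T - H). \<exists>j\<in>#mset_set (H \<inter> T). (k, j) \<in> r"
      proof
        fix k assume "k \<in># mset_set (T - H)"
        then have k: "k \<in> T" "k \<notin> H" using finT by auto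
        then have "k < m" using m by (metis order.not_eq_order_implies_strict)
        then have "(k, m) \<in> r" using k m TX by (auto simp: r_def)
        moreover have "m \<in># mset_set (H \<inter> T)" using m finH by auto
        ultimately show "\<exists>j\<in>#mset_set (H \<inter> T). (k, j) \<in> r" by blast
      qed
    qed
    then show "(H', H) \<in> inv_image (mult r) mset_set"
      by (simp add: 1 2)
  qed
  ultimately show ?thesis by (rule wf_subset)
qed

text \<open>
  So that \<open>n\<close> can vary (and be \<open>0\<close>), \<open>F\<^sup>n\<close> consists of the sequences over the field \<open>F\<close> that
  vanish from index \<open>n\<close> on. All these live in the vector space of all sequences,
  so subspaces and dimension are those of the ambient space.
\<close>

definition seq_scale :: "'k::field \<Rightarrow> (nat \<Rightarrow> 'k) \<Rightarrow> (nat \<Rightarrow> 'k)" where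
  "seq_scale c v = (\<lambda>i. c * v i)"

global_interpretation seq: vector_space "seq_scale :: 'k::field \<Rightarrow> (nat \<Rightarrow> 'k) \<Rightarrow> (nat \<Rightarrow> 'k)"
  by unfold_locales (auto simp: seq_scale_def fun_eq_iff algebra_simps)

definition coord_space :: "nat \<Rightarrow> (nat \<Rightarrow> 'k::field) set" where
  "coord_space n = {v. \<forall>i\<ge>n. v i = 0}"

definition subspaces :: "nat \<Rightarrow> (nat \<Rightarrow> 'k::field) set set" where
  "subspaces n = {W. seq.subspace W \<and> W \<subseteq> coord_space n}"

definition g_q :: "'k::field itself \<Rightarrow> nat \<Rightarrow> nat" where
  "g_q _ d = ruler_grundy (subspaces d) (coord_space d :: (nat \<Rightarrow> 'k) set)"

lemma finite_subspaces: "finite (subspaces n :: (nat \<Rightarrow> 'k::{field,finite}) set set)"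
proof -
  have "(coord_space n :: (nat \<Rightarrow> 'k) set)
      \<subseteq> {f. \<forall>i. (i \<in> {..<n} \<longrightarrow> f i \<in> UNIV) \<and> (i \<notin> {..<n} \<longrightarrow> f i = 0)}"
    by (auto simp: coord_space_def)
  then have "finite (coord_space n :: (nat \<Rightarrow> 'k) set)"
    by (rule finite_subset) (rule finite_set_of_finite_funs; simp)
  then show ?thesis
    by (intro finite_subset[of "subspaces n" "Pow (coord_space n)"]) (auto simp: subspaces_def)
qed

lemma wf_ruler_subspaces:
  "wf (coin_moves (subspaces n :: (nat \<Rightarrow> 'k::{field,finite}) set set)
                  (closed_intervals (subspaces n)))"
  by (rule wf_coin_moves[OF finite_subspaces]) (auto simp: closed_intervals_def)

lemma coord_space_in_subspaces: "coord_space n \<in> subspaces n"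
  by (auto simp: subspaces_def seq.subspace_def coord_space_def seq_scale_def)

lemma dim_coord_space: "seq.dim (coord_space n :: (nat \<Rightarrow> 'k::field) set) = n"
proof -
  define e :: "nat \<Rightarrow> nat \<Rightarrow> 'k" where "e i = (\<lambda>j. if j = i then 1 else 0)" for i
  have inj: "inj e"
    by (rule injI) (metis e_def zero_neq_one)
  have sum_e: "(\<Sum>v\<in>e ` {..<n}. seq_scale (u v) v) i = (if i < n then u (e i) else 0)" for u i
  proof -
    have ev: "(\<Sum>j\<in>A. F j) i = (\<Sum>j\<in>A. F j i)" for F :: "nat \<Rightarrow> nat \<Rightarrow> 'k" and A
      by (induction A rule: infinite_finite_induct) auto
    have "(\<Sum>v\<in>e ` {..<n}. seq_scale (u v) v) = (\<Sum>j<n. seq_scale (u (e j)) (e j))"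
      using inj by (subst sum.reindex) (auto intro: inj_on_subset)
    then have "(\<Sum>v\<in>e ` {..<n}. seq_scale (u v) v) i = (\<Sum>j<n. if i = j then u (e j) else 0)"
      by (simp add: ev seq_scale_def e_def if_distrib[of "(*) _"] cong: if_cong)
    then show ?thesis by simp
  qed
  have "seq.dim (coord_space n :: (nat \<Rightarrow> 'k) set) = card (e ` {..<n})"
  proof (rule seq.dim_unique)
    show "e ` {..<n} \<subseteq> coord_space n"
      by (auto simp: e_def coord_space_def)
    show "coord_space n \<subseteq> seq.span (e ` {..<n})"
    proof
      fix v :: "nat \<Rightarrow> 'k" assume v: "v \<in> coord_space n"
      have "v = (\<Sum>w\<in>e ` {..<n}. seq_scale (v (inv e w)) w)"
        using v by (auto simp: fun_eq_iff sum_e inv_f_f[OF inj] coord_space_def)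
      also have "\<dots> \<in> seq.span (e ` {..<n})"
        by (intro seq.span_sum seq.span_scale seq.span_base)
      finally show "v \<in> seq.span (e ` {..<n})" .
    qed
    show "seq.independent (e ` {..<n})"
    proof (rule seq.independent_if_scalars_zero)
      fix u x assume "(\<Sum>x\<in>e ` {..<n}. seq_scale (u x) x) = 0" and x: "x \<in> e ` {..<n}"
      then obtain i where "i < n" "x = e i"
        and "(\<Sum>x\<in>e ` {..<n}. seq_scale (u x) x) i = 0" by auto
      then show "u x = 0" by (simp add: sum_e)
    qed simp
  qed simp
  also have "\<dots> = n"
    using inj by (subst card_image) (auto intro: inj_on_subset)
  finally show ?thesis .
qed

end

theory Submission
  imports Defs
begin

text \<open>
  By Sprague--Grundy theory it suffices to check that the claimed values \<open>c (dim W)\<close> satisfy the mex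
  recursion, so the nim-sums of \<open>c (dim U)\<close> over the intervals \<open>[A, W]\<close> are needed. Fix a hyperplane
  \<open>H\<close> of \<open>W\<close> containing \<open>A\<close>. Each \<open>V\<close> in \<open>[A, H]\<close> is \<open>U \<inter> H\<close> for exactly
  \<open>q ^ (dim H - dim V)\<close> subspaces \<open>U\<close> of \<open>W\<close> not inside \<open>H\<close>, all of dimension \<open>dim V + 1\<close>.

  If \<open>q\<close> is even, this number is odd only for \<open>V = H\<close>, so passing from \<open>H\<close> to \<open>W\<close> merely adds the term
  \<open>c (dim W)\<close>, as in the ruler game on a chain. If \<open>q\<close> is odd, it is always odd, so passing from \<open>H\<close>
  to \<open>W\<close> replaces \<open>c i\<close> by \<open>c i \<oplus> c (i + 1)\<close>, which equals \<open>c (i + 2)\<close> for \<open>c i = i mod 3 + 1\<close>: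
  nim-addition on \<open>{0, 1, 2, 3}\<close> is addition in the field with four elements, \<open>c i\<close> is the \<open>i\<close>-th power
  of a generator \<open>\<omega>\<close>, and \<open>1 + \<omega> = \<omega>\<^sup>2\<close>.
\<close>

unbundle bit_operations_syntax

section \<open>Nim-sums and minimal excludants\<close>

text \<open>Makes the big-operator calculus of commutative monoids available for XOR.\<close>

global_interpretation nim_sum: comm_monoid_set "xor :: nat \<Rightarrow> nat \<Rightarrow> nat" 0
  defines nim_sum = nim_sum.F
  by (rule comm_monoid_set.intro) (rule xor.comm_monoid_axioms)

lemma xor_nat_left_self [simp]: "a XOR (a XOR b) = (b :: nat)"
  by (simp flip: xor.assoc)

lemma xor_nat_right_self [simp]: "(a XOR b) XOR b = (a :: nat)"
  by (simp add: xor.assoc)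

lemma xor_nat_eq_0_iff [simp]: "a XOR b = 0 \<longleftrightarrow> a = (b :: nat)"
  by (metis xor_nat_left_self xor_self_eq xor.right_neutral)

lemma xor_nat_div_2: "(a XOR b) div 2 = (a div 2) XOR (b div 2 :: nat)"
  by (subst xor_rec) simp

lemma xor_nat_div_power_2: "(a XOR b) div 2 ^ n = (a div 2 ^ n) XOR (b div 2 ^ n :: nat)"
  using drop_bit_xor[of n a b] by (simp add: drop_bit_eq_div)

text \<open>Two-heap Nim, by recursion on binary digits. If halving keeps the inequality strict,
  induction applies. Otherwise \<open>v\<close> is \<open>a XOR b\<close> with a last digit 1
  cleared, and whichever of \<open>a\<close>, \<open>b\<close> is odd drops by one.\<close>

lemma less_xor_cases:
  fixes v a b :: nat
  assumes "v < a XOR b"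
  shows "v XOR b < a \<or> v XOR a < b"
  using assms
proof (induction a arbitrary: b v rule: less_induct)
  case (less a)
  show ?case
  proof (cases "a = 0")
    case True
    with less.prems show ?thesis by simp
  next
    case False
    show ?thesis
    proof (cases "v div 2 < a div 2 XOR b div 2")
      case True
      with less.IH[of "a div 2" "v div 2" "b div 2"] False
      have "(v XOR b) div 2 < a div 2 \<or> (v XOR a) div 2 < b div 2"
        by (simp add: xor_nat_div_2)
      then show ?thesis by (metis div_le_mono not_le)
    next
      case nless: False
      have ab: "a XOR b = of_bool (odd a \<noteq> odd b) + 2 * (a div 2 XOR b div 2)"
        by (rule xor_rec)
      have le: "2 * (a div 2 XOR b div 2) \<le> v" using nless by linarith
      then have odd: "odd a \<noteq> odd b" using less.prems ab by (cases "odd a = odd b") auto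
      have v: "v = 2 * (a div 2 XOR b div 2)" using le less.prems ab odd by simp
      have v2: "v div 2 = a div 2 XOR b div 2" "even v" using v by simp_all
      have "v XOR b = of_bool (odd b) + 2 * (a div 2)"
        using v2 by (subst xor_rec) simp
      moreover have "v XOR a = of_bool (odd a) + 2 * (b div 2)"
        using v2 by (subst xor_rec) (simp add: xor.commute)
      ultimately show ?thesis using odd by (cases "odd a") (auto elim!: oddE evenE)
    qed
  qed
qed

text \<open>Replacing the term \<open>f x\<close> by \<open>f x XOR (nim_sum f H XOR v)\<close>
  changes the total to \<open>v\<close>. As in the winning strategy of Nim, some \<open>x\<close>
  makes this a decrease.\<close>

lemma less_nim_sum_obtains:
  assumes "finite H" and "v < nim_sum f H"
  obtains x where "x \<in> H" and "f x XOR (nim_sum f H XOR v) < f x"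
proof -
  have "\<exists>x\<in>H. f x XOR (nim_sum f H XOR v) < f x"
    using assms
  proof (induction H arbitrary: v rule: finite_induct)
    case (insert y H)
    then have "v < f y XOR nim_sum f H" by simp
    then consider "v XOR nim_sum f H < f y" | "v XOR f y < nim_sum f H"
      using less_xor_cases by blast
    then show ?case
    proof cases
      case 1
      then have "f y XOR (nim_sum f (insert y H) XOR v) < f y"
        using insert.hyps by (simp add: ac_simps)
      then show ?thesis by blast
    next
      case 2
      from insert.IH[OF this] obtain x where
        "x \<in> H" "f x XOR (nim_sum f H XOR (v XOR f y)) < f x" by blast
      moreover have "nim_sum f H XOR (v XOR f y) = nim_sum f (insert y H) XOR v"
        using insert.hyps by (simp add: ac_simps)
      ultimately show ?thesis by auto
    qed
  qed simp
  with that show thesis by blast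
qed

lemma nim_sum_sym_diff:
  assumes "finite A" "finite B"
  shows "nim_sum f (sym_diff A B) = nim_sum f A XOR nim_sum f B"
proof -
  have "nim_sum f (sym_diff A B) = nim_sum f (A - B) XOR nim_sum f (B - A)"
    using assms by (intro nim_sum.union_disjoint) auto
  moreover have "nim_sum f A = nim_sum f (A \<inter> B) XOR nim_sum f (A - B)"
    by (rule nim_sum.Int_Diff) fact
  moreover have "nim_sum f B = nim_sum f (A \<inter> B) XOR nim_sum f (B - A)"
    using nim_sum.Int_Diff[OF \<open>finite B\<close>, of f A] by (simp add: Int_commute)
  ultimately show ?thesis by (simp add: ac_simps)
qed

lemma nim_sum_constant: "finite A \<Longrightarrow> nim_sum (\<lambda>_. c) A = (if odd (card A) then c else 0)"
  by (induction A rule: finite_induct) auto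

lemma mex_eqI:
  assumes "x \<notin> S" and "\<And>y. y < x \<Longrightarrow> y \<in> S"
  shows "mex S = x"
  unfolding mex_def using assms by (intro Least_equality) (auto intro: leI)

lemma mex_notin: "finite S \<Longrightarrow> mex S \<notin> S"
  unfolding mex_def by (rule LeastI_ex) (rule ex_new_if_finite[OF infinite_UNIV_nat])

lemma less_mexD: "y < mex S \<Longrightarrow> y \<in> S"
  unfolding mex_def using not_less_Least by blast

section \<open>Sprague--Grundy theory of coin-turning games\<close>

text \<open>Any solution \<open>f\<close> of the mex recursion gives the value of every position, so
  a guessed \<open>f\<close> only has to be checked. Arbitrary \<open>H\<close> are treated because
  moves lead out of the singletons. Turning \<open>T\<close> XORs the total with
  \<open>nim_sum f T\<close>.\<close>

lemma sprague_grundy_coin_moves: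
  fixes X :: "'a::order set"
  assumes fin: "finite X" and sub: "\<And>T. T \<in> \<T> \<Longrightarrow> T \<subseteq> X"
    and f: "\<And>x. x \<in> X \<Longrightarrow>
      f x = mex {nim_sum f (T - {x}) | T. T \<in> \<T> \<and> x \<in> T \<and> (\<forall>t\<in>T. t \<le> x)}"
    and "H \<subseteq> X"
  shows "sprague_grundy (coin_moves X \<T>) H = nim_sum f H"
proof -
  have wf: "wf (coin_moves X \<T>)" by (rule wf_coin_moves[OF fin sub])
  have finT: "finite T" if "T \<in> \<T>" for T using sub[OF that] fin finite_subset by blast
  have finTs: "finite \<T>" by (rule finite_subset[of _ "Pow X"]) (use sub fin in auto)
  have split: "nim_sum f T = f x XOR nim_sum f (T - {x})" if "T \<in> \<T>" "x \<in> T" for T x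
    using finT that by (simp add: nim_sum.remove)
  show ?thesis using wf \<open>H \<subseteq> X\<close>
  proof (induction H rule: wf_induct_rule)
    case (less H)
    have finH: "finite H" using less.prems fin finite_subset by blast
    let ?opts = "{H'. (H', H) \<in> coin_moves X \<T>}"
    have "sprague_grundy (coin_moves X \<T>) ` ?opts = nim_sum f ` ?opts"
    proof (rule image_cong[OF refl])
      fix H' assume "H' \<in> ?opts"
      then have mv: "(H', H) \<in> coin_moves X \<T>" by simp
      then have "H' \<subseteq> X" using sub by (fastforce simp: coin_moves_def)
      with less.IH[OF mv] show "sprague_grundy (coin_moves X \<T>) H' = nim_sum f H'" .
    qed
    then have "sprague_grundy (coin_moves X \<T>) H = mex (nim_sum f ` ?opts)"
      by (simp add: sprague_grundy_unfold[OF wf, of H])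
    also have "\<dots> = nim_sum f H"
    proof (rule mex_eqI)
      show "nim_sum f H \<notin> nim_sum f ` ?opts"
      proof
        assume "nim_sum f H \<in> nim_sum f ` ?opts"
        then obtain T x where T: "T \<in> \<T>" "x \<in> T" "\<forall>t\<in>T. t \<le> x"
          and "x \<in> H" and eq: "nim_sum f H = nim_sum f (sym_diff H T)"
          by (auto simp: coin_moves_def)
        \<comment> \<open>An unchanged total forces \<open>nim_sum f T = 0\<close>, which makes
          \<open>f x\<close> one of the options of which it is the mex.\<close>
        have "nim_sum f H = nim_sum f H XOR nim_sum f T"
          using eq nim_sum_sym_diff[OF finH finT[OF T(1)]] by simp
        then have "nim_sum f T = 0" by (metis xor_nat_left_self xor_self_eq)
        then have "f x = nim_sum f (T - {x})" using split[OF T(1,2)] by simp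
        moreover have xX: "x \<in> X" using \<open>x \<in> H\<close> less.prems by blast
        moreover have "finite {nim_sum f (T - {x}) | T. T \<in> \<T> \<and> x \<in> T \<and> (\<forall>t\<in>T. t \<le> x)}"
          using finTs by simp
        then have "f x \<notin> {nim_sum f (T - {x}) | T. T \<in> \<T> \<and> x \<in> T \<and> (\<forall>t\<in>T. t \<le> x)}"
          unfolding f[OF xX] by (rule mex_notin)
        ultimately show False using T by blast
      qed
    next
      fix v assume "v < nim_sum f H"
      then obtain x where x: "x \<in> H" "f x XOR (nim_sum f H XOR v) < f x"
        using less_nim_sum_obtains[OF finH] by blast
      then have "x \<in> X" using less.prems by blast
      \<comment> \<open>Being below \<open>f x\<close>, the replacement value is an option at
        \<open>x\<close>; turning the \<open>T\<close> that realises it leads to total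
        \<open>v\<close>.\<close>
      have "f x XOR (nim_sum f H XOR v)
          \<in> {nim_sum f (T - {x}) | T. T \<in> \<T> \<and> x \<in> T \<and> (\<forall>t\<in>T. t \<le> x)}"
        by (rule less_mexD, fold f[OF \<open>x \<in> X\<close>]) (rule x(2))
      then obtain T where T: "T \<in> \<T>" "x \<in> T" "\<forall>t\<in>T. t \<le> x"
        and "nim_sum f (T - {x}) = f x XOR (nim_sum f H XOR v)" by auto
      then have "nim_sum f T = nim_sum f H XOR v" using split[OF T(1,2)] by simp
      then have "v = nim_sum f (sym_diff H T)"
        using nim_sum_sym_diff[OF finH finT[OF T(1)]] by simp
      moreover have "(sym_diff H T, H) \<in> coin_moves X \<T>"
        unfolding coin_moves_def using T x less.prems by blast
      ultimately show "v \<in> nim_sum f ` ?opts" by blast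
    qed
    finally show ?case .
  qed
qed

section \<open>Subspaces over a finite field\<close>

lemma mem_span_insert_iff:
  assumes "seq.subspace H"
  shows "x \<in> seq.span (insert w H) \<longleftrightarrow> (\<exists>c. x - seq_scale c w \<in> H)"
  using assms by (simp add: seq.span_insert seq.span_eq_iff[THEN iffD2])

lemma scale_mem_subspace_iff:
  assumes "seq.subspace H" "w \<notin> H"
  shows "seq_scale c w \<in> H \<longleftrightarrow> c = 0"
proof
  assume "seq_scale c w \<in> H"
  then have "seq_scale (inverse c) (seq_scale c w) \<in> H"
    by (rule seq.subspace_scale[OF assms(1)])
  then show "c = 0" using assms(2) by (cases "c = 0") auto
qed (simp add: seq.subspace_0[OF assms(1)])

text \<open>Counts pairs \<open>(c, h)\<close>: no nonzero multiple of \<open>w\<close> lies in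
  \<open>H\<close>, so \<open>seq_scale c w + h\<close> determines both.\<close>

lemma card_span_insert:
  fixes H :: "(nat \<Rightarrow> 'k::{field,finite}) set"
  assumes fin: "finite H" and H: "seq.subspace H" and w: "w \<notin> H"
  shows "finite (seq.span (insert w H))"
    and "card (seq.span (insert w H)) = CARD('k) * card H"
proof -
  have "bij_betw (\<lambda>(c, h). seq_scale c w + h) (UNIV \<times> H) (seq.span (insert w H))"
  proof (rule bij_betw_imageI)
    show "inj_on (\<lambda>(c, h). seq_scale c w + h) (UNIV \<times> H)"
    proof (rule inj_onI, clarify)
      fix c h c' h' assume h: "h \<in> H" "h' \<in> H"
        and eq: "seq_scale c w + h = seq_scale c' w + h'"
      have "seq_scale (c - c') w = h' - h"
        using eq by (simp add: seq.scale_left_diff_distrib algebra_simps)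
      then have "seq_scale (c - c') w \<in> H" using h seq.subspace_diff[OF H] by simp
      then have "c = c'" using scale_mem_subspace_iff[OF H w] by simp
      then show "c = c' \<and> h = h'" using eq by simp
    qed
    show "(\<lambda>(c, h). seq_scale c w + h) ` (UNIV \<times> H) = seq.span (insert w H)"
    proof (intro equalityI subsetI)
      fix x assume "x \<in> seq.span (insert w H)"
      then obtain c where "x - seq_scale c w \<in> H" by (auto simp: mem_span_insert_iff[OF H])
      then show "x \<in> (\<lambda>(c, h). seq_scale c w + h) ` (UNIV \<times> H)"
        by (intro image_eqI[of _ _ "(c, x - seq_scale c w)"]) auto
    next
      fix x assume "x \<in> (\<lambda>(c, h). seq_scale c w + h) ` (UNIV \<times> H)"
      then obtain c h where "h \<in> H" "x = seq_scale c w + h" by auto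
      then have "x - seq_scale c w \<in> H" by simp
      then show "x \<in> seq.span (insert w H)" unfolding mem_span_insert_iff[OF H] ..
    qed
  qed
  then show "finite (seq.span (insert w H))"
    and "card (seq.span (insert w H)) = CARD('k) * card H"
    using fin bij_betw_finite bij_betw_same_card by fastforce+
qed

lemma card_span_independent:
  fixes B :: "(nat \<Rightarrow> 'k::{field,finite}) set"
  assumes "finite B" and "seq.independent B"
  shows "finite (seq.span B) \<and> card (seq.span B) = CARD('k) ^ card B"
  using assms
proof (induction B rule: finite_induct)
  case (insert w B)
  then have w: "w \<notin> seq.span B" and ind: "seq.independent B"
    by (auto simp: seq.independent_insert)
  have "seq.span (insert w B) = seq.span (insert w (seq.span B))"
    by (simp add: seq.span_insert seq.span_span)
  then show ?case
    using card_span_insert[of "seq.span B" w] insert w ind by simp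
qed simp

text \<open>Lets dimensions be compared through cardinalities, both for monotonicity and for the
  later count of subspaces.\<close>

lemma card_subspace:
  fixes W :: "(nat \<Rightarrow> 'k::{field,finite}) set"
  assumes "finite W" and "seq.subspace W"
  shows "card W = CARD('k) ^ seq.dim W"
proof -
  obtain B where B: "B \<subseteq> W" "seq.independent B" "W \<subseteq> seq.span B" "card B = seq.dim W"
    by (rule seq.basis_exists)
  have "seq.span B = W" using B assms(2) by (metis seq.span_subspace)
  moreover have "finite B" using B assms(1) finite_subset by blast
  ultimately show ?thesis using card_span_independent[of B] B by simp
qed

lemma card_field_gt_1: "1 < CARD('k::{field,finite})"
proof -
  have "card {0, 1 :: 'k} \<le> CARD('k)" by (rule card_mono) auto
  then show ?thesis by simp
qed

lemma dim_insert_subspace: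
  fixes H :: "(nat \<Rightarrow> 'k::{field,finite}) set"
  assumes "finite H" and "seq.subspace H" and "w \<notin> H"
  shows "seq.dim (insert w H) = Suc (seq.dim H)"
proof -
  have "CARD('k) ^ seq.dim (seq.span (insert w H)) = CARD('k) ^ Suc (seq.dim H)"
    using card_span_insert[OF assms] card_subspace[OF assms(1,2)]
      card_subspace[of "seq.span (insert w H)"] by simp
  then show ?thesis
    using card_field_gt_1[where 'k='k] power_inject_exp by (metis seq.dim_span)
qed

lemma dim_subspace_less:
  fixes W :: "(nat \<Rightarrow> 'k::{field,finite}) set"
  assumes "finite W" "seq.subspace A" "seq.subspace W" "A \<subset> W"
  shows "seq.dim A < seq.dim W"
proof -
  have "CARD('k) ^ seq.dim A < CARD('k) ^ seq.dim W"
    using psubset_card_mono[OF assms(1,4)] card_subspace[OF _ assms(2)]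
      card_subspace[OF assms(1,3)] assms finite_subset by (metis psubset_imp_subset)
  then show ?thesis using card_field_gt_1[where 'k='k] power_less_imp_less_exp by blast
qed

lemma dim_subspace_mono:
  fixes W :: "(nat \<Rightarrow> 'k::{field,finite}) set"
  assumes "finite W" "seq.subspace A" "seq.subspace W" "A \<subseteq> W"
  shows "seq.dim A \<le> seq.dim W"
proof (cases "A = W")
  case False
  with assms show ?thesis by (intro less_imp_le[OF dim_subspace_less]) auto
qed simp

text \<open>Take \<open>H\<close> maximal among the proper subspaces of \<open>W\<close> containing
  \<open>A\<close>; adjoining any further vector of \<open>W\<close> must then give all of
  \<open>W\<close>.\<close>

lemma hyperplane_exists:
  fixes W :: "(nat \<Rightarrow> 'k::{field,finite}) set"
  assumes fin: "finite W" and W: "seq.subspace W" and A: "seq.subspace A" "A \<subset> W"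
  obtains H w where "seq.subspace H" "A \<subseteq> H" "H \<subset> W" "w \<notin> H"
    "W = seq.span (insert w H)" "seq.dim W = Suc (seq.dim H)"
proof -
  let ?S = "{H. seq.subspace H \<and> A \<subseteq> H \<and> H \<subset> W}"
  have finS: "finite ?S" by (rule finite_subset[of _ "Pow W"]) (use fin in auto)
  have "A \<in> ?S" using A by simp
  then have "?S \<noteq> {}" by (rule ex_in_conv[THEN iffD1, OF exI])
  from finite_has_maximal[OF finS this]
  obtain H where H: "H \<in> ?S" and max: "\<forall>U\<in>?S. H \<subseteq> U \<longrightarrow> H = U" by (rule bexE)
  then obtain w where w: "w \<in> W" "w \<notin> H" by blast
  have "seq.span (insert w H) \<subseteq> W"
    using W H w by (intro seq.span_minimal) auto
  moreover have "insert w H \<subseteq> seq.span (insert w H)" by (rule seq.span_superset)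
  ultimately have span: "seq.span (insert w H) = W"
    using bspec[OF max, of "seq.span (insert w H)"] H w by auto
  have "finite H" using H fin finite_subset by blast
  show thesis
  proof (rule that)
    show "seq.dim W = Suc (seq.dim H)"
      using dim_insert_subspace[OF \<open>finite H\<close> _ w(2)] H by (simp flip: span)
  qed (use H w span in auto)
qed

text \<open>Descends through hyperplanes. Lower endpoints of every dimension up to that of the top
  therefore occur, and the mex runs over all of \<open>{..d}\<close>.\<close>

lemma subspace_of_dim_exists:
  fixes W :: "(nat \<Rightarrow> 'k::{field,finite}) set"
  assumes "finite W" "seq.subspace W" "k \<le> seq.dim W"
  shows "\<exists>A\<subseteq>W. seq.subspace A \<and> seq.dim A = k"
  using assms
proof (induction "seq.dim W - k" arbitrary: W)
  case 0
  then show ?case by auto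
next
  case (Suc j)
  have "seq.dim {0 :: nat \<Rightarrow> 'k} = 0" 
    by (rule seq.dim_unique[of "{}"]) (auto simp: seq.independent_empty)
  then have "W \<noteq> {0}" using Suc.hyps(2) by auto
  then have "{0} \<subset> W" using seq.subspace_0[OF Suc.prems(2)] by blast
  then obtain H w where H: "seq.subspace H" "H \<subset> W" "seq.dim W = Suc (seq.dim H)"
    using hyperplane_exists[OF Suc.prems(1,2) seq.subspace_single_0] by metis
  have "finite H" using H Suc.prems(1) finite_subset by blast
  with Suc.hyps(1)[of H] H Suc.hyps(2) have "\<exists>A\<subseteq>H. seq.subspace A \<and> seq.dim A = k" by simp
  with H show ?case by blast
qed

section \<open>Nim-sums over intervals of subspaces\<close>

text \<open>The interval \<open>[A, W]\<close> freed of the ambient \<open>n\<close>, so that values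
  computed from it cannot depend on \<open>n\<close>.\<close>

definition subspaces_between ::
    "(nat \<Rightarrow> 'k::field) set \<Rightarrow> (nat \<Rightarrow> 'k) set \<Rightarrow> (nat \<Rightarrow> 'k) set set" where
  "subspaces_between A W = {U. seq.subspace U \<and> A \<subseteq> U \<and> U \<subseteq> W}"

lemma finite_subspaces_between: "finite W \<Longrightarrow> finite (subspaces_between A W)"
  by (rule finite_subset[of _ "Pow W"]) (auto simp: subspaces_between_def)

text \<open>Modulo \<open>H\<close>, every vector of \<open>U\<close> is a multiple of
  \<open>w\<close>, hence of \<open>x\<close>; so \<open>U\<close> has just one dimension beyond
  \<open>U \<inter> H\<close>.\<close>

lemma subspace_eq_span_insert:
  assumes H: "seq.subspace H" and U: "seq.subspace U" "U \<subseteq> seq.span (insert w H)"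
    and x: "x \<in> U" "x \<notin> H"
  shows "U = seq.span (insert x (U \<inter> H))"
proof
  have UH: "seq.subspace (U \<inter> H)" by (rule seq.subspace_inter[OF U(1) H])
  show "seq.span (insert x (U \<inter> H)) \<subseteq> U"
    using U x by (intro seq.span_minimal) auto
  obtain a where a: "x - seq_scale a w \<in> H"
    using x(1) U(2) mem_span_insert_iff[OF H] by blast
  then have "a \<noteq> 0" using x by auto
  show "U \<subseteq> seq.span (insert x (U \<inter> H))"
  proof
    fix y assume y: "y \<in> U"
    obtain b where b: "y - seq_scale b w \<in> H"
      using y U(2) mem_span_insert_iff[OF H] by blast
    \<comment> \<open>\<open>a\<close> and \<open>b\<close> are the \<open>w\<close>-coordinates of
      \<open>x\<close> and \<open>y\<close>, so the factor \<open>b / a\<close> cancels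
      \<open>w\<close>.\<close>
    have "y - seq_scale (b / a) x = (y - seq_scale b w) - seq_scale (b / a) (x - seq_scale a w)"
      using \<open>a \<noteq> 0\<close> by (simp add: seq.scale_right_diff_distrib)
    also have "\<dots> \<in> H"
      by (intro seq.subspace_diff[OF H] seq.subspace_scale[OF H] a b)
    finally have "y - seq_scale (b / a) x \<in> H" .
    moreover have "y - seq_scale (b / a) x \<in> U"
      by (intro seq.subspace_diff[OF U(1)] seq.subspace_scale[OF U(1)] x y)
    ultimately show "y \<in> seq.span (insert x (U \<inter> H))"
      unfolding mem_span_insert_iff[OF UH] by blast
  qed
qed

text \<open>
  The map \<open>h \<mapsto> \<langle>V, w + h\<rangle>\<close> sends \<open>H\<close> onto the subspaces of \<open>W\<close> that meet the hyperplane \<open>H\<close>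
  exactly in \<open>V\<close> without lying in \<open>H\<close>, and its fibres are cosets of \<open>V\<close>.
\<close>

lemma card_subspaces_over_hyperplane:
  fixes H :: "(nat \<Rightarrow> 'k::{field,finite}) set"
  assumes fin: "finite H" and H: "seq.subspace H" and w: "w \<notin> H"
    and V: "seq.subspace V" "V \<subseteq> H"
  defines "F \<equiv> {U. seq.subspace U \<and> U \<subseteq> seq.span (insert w H) \<and> \<not> U \<subseteq> H \<and> U \<inter> H = V}"
  shows "card F * card V = card H"
proof -
  define \<phi> where "\<phi> h = seq.span (insert (w + h) V)" for h
  have notH: "w + h \<notin> H" if "h \<in> H" for h
    using seq.subspace_diff[OF H _ that, of "w + h"] w by auto
  \<comment> \<open>By \<open>subspace_eq_span_insert\<close>, a member of \<open>F\<close> is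
    spanned by its trace \<open>V\<close> and any one of its vectors outside
    \<open>H\<close>.\<close>
  have \<phi>_eq: "\<phi> h = U \<longleftrightarrow> w + h \<in> U" if "h \<in> H" "U \<in> F" for h U
  proof
    assume "w + h \<in> U"
    then show "\<phi> h = U"
      using subspace_eq_span_insert[OF H, of U w "w + h"] that notH
      by (auto simp: F_def \<phi>_def)
  qed (auto simp: \<phi>_def intro: seq.span_base)
  have \<phi>_in: "\<phi> h \<in> F" if h: "h \<in> H" for h
  proof -
    have "w + h \<in> \<phi> h" by (auto simp: \<phi>_def intro: seq.span_base)
    moreover have "\<phi> h \<subseteq> seq.span (insert w H)"
      unfolding \<phi>_def using V h
      by (intro seq.span_minimal) (auto intro: seq.span_base seq.span_add)
    moreover have "V \<subseteq> \<phi> h" by (auto simp: \<phi>_def intro: seq.span_base)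
    \<comment> \<open>Both \<open>y\<close> and \<open>y - seq_scale c (w + h)\<close> lie in
      \<open>H\<close> while \<open>w + h\<close> does not, so \<open>c = 0\<close>.\<close>
    moreover have "y \<in> V" if y: "y \<in> \<phi> h" "y \<in> H" for y
    proof -
      obtain c where c: "y - seq_scale c (w + h) \<in> V"
        using y by (auto simp: \<phi>_def mem_span_insert_iff[OF V(1)])
      then have "y - seq_scale c (w + h) \<in> H" using V by blast
      from seq.subspace_diff[OF H y(2) this]
      have "c = 0" using scale_mem_subspace_iff[OF H notH[OF h]] by simp
      with c show ?thesis by simp
    qed
    ultimately show ?thesis
      unfolding F_def using notH[OF h] V by (auto simp: \<phi>_def)
  qed
  have fib: "card {h \<in> H. \<phi> h = U} = card V" if U: "U \<in> F" for U
  proof -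
    have sU: "seq.subspace U" using U by (simp add: F_def)
    obtain x where x: "x \<in> U" "x \<notin> H" using U by (auto simp: F_def)
    obtain a where a: "x - seq_scale a w \<in> H"
      using x(1) U mem_span_insert_iff[OF H] unfolding F_def by blast
    then have "a \<noteq> 0" using x by auto
    \<comment> \<open>Rescaling \<open>x\<close> to \<open>w\<close>-coordinate 1 puts
      \<open>w + h\<close> in \<open>U\<close>, so the fibre is nonempty.\<close>
    define h where "h = seq_scale (inverse a) (x - seq_scale a w)"
    have h: "h \<in> H" unfolding h_def by (intro seq.subspace_scale[OF H] a)
    have "w + h = seq_scale (inverse a) x"
      using \<open>a \<noteq> 0\<close> by (simp add: h_def seq.scale_right_diff_distrib)
    then have wh: "w + h \<in> U" using seq.subspace_scale[OF sU x(1)] by simp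
    have "{h \<in> H. \<phi> h = U} = (+) h ` V"
    proof (intro equalityI subsetI)
      fix h' assume "h' \<in> {h \<in> H. \<phi> h = U}"
      then have h': "h' \<in> H" "w + h' \<in> U" using \<phi>_eq U by auto
      have "(w + h') - (w + h) \<in> U" by (rule seq.subspace_diff[OF sU h'(2) wh])
      then have "h' - h \<in> U \<inter> H" using seq.subspace_diff[OF H h'(1) h] by simp
      then have "h' - h \<in> V" using U unfolding F_def by blast
      then show "h' \<in> (+) h ` V" by (rule rev_image_eqI) simp
    next
      fix h' assume "h' \<in> (+) h ` V"
      then obtain v where v: "v \<in> V" "h' = h + v" by blast
      then have "v \<in> U" "v \<in> H" using U by (auto simp: F_def)
      then have "(w + h) + v \<in> U" "h' \<in> H"
        using seq.subspace_add[OF sU wh] seq.subspace_add[OF H h] v by auto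
      then show "h' \<in> {h \<in> H. \<phi> h = U}" using \<phi>_eq U v by (simp add: add.assoc)
    qed
    then show ?thesis by (simp add: card_image)
  qed
  have finF: "finite F"
    by (rule finite_subset[of _ "Pow (seq.span (insert w H))"])
      (use card_span_insert(1)[OF fin H w] in \<open>auto simp: F_def\<close>)
  have "card H = (\<Sum>U\<in>F. card {h \<in> H. \<phi> h = U})"
    using sum.group[OF fin finF, of \<phi> "\<lambda>_. 1::nat"] \<phi>_in by (simp add: image_subset_iff)
  also have "\<dots> = card F * card V" using fib by simp
  finally show ?thesis ..
qed

text \<open>Sorts the subspaces outside \<open>H\<close> by their trace \<open>V\<close> on
  \<open>H\<close>. Those over one \<open>V\<close> share a dimension, so together they contribute
  their common term or nothing, by the parity of their number. Leaving \<open>c\<close> arbitrary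
  lets both parities of \<open>q\<close> use this recursion.\<close>

lemma nim_sum_between_span_insert:
  fixes H :: "(nat \<Rightarrow> 'k::{field,finite}) set"
  assumes fin: "finite H" and H: "seq.subspace H" and w: "w \<notin> H" and AH: "A \<subseteq> H"
  shows "nim_sum (\<lambda>U. c (seq.dim U)) (subspaces_between A (seq.span (insert w H))) =
    nim_sum (\<lambda>U. c (seq.dim U)) (subspaces_between A H) XOR
    nim_sum (\<lambda>V. if odd (CARD('k) ^ (seq.dim H - seq.dim V)) then c (Suc (seq.dim V)) else 0)
      (subspaces_between A H)"
proof -
  let ?W = "seq.span (insert w H)" and ?f = "\<lambda>U :: (nat \<Rightarrow> 'k) set. c (seq.dim U)"
  define S where "S = {U \<in> subspaces_between A ?W. \<not> U \<subseteq> H}"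
  have finW: "finite ?W" by (rule card_span_insert(1)[OF fin H w])
  have finS: "finite S" using finite_subspaces_between[OF finW] by (simp add: S_def)
  have HW: "H \<subseteq> ?W" by (auto intro: seq.span_base)
  have split: "subspaces_between A ?W = subspaces_between A H \<union> S"
    using HW by (auto simp: S_def subspaces_between_def)
  have "nim_sum ?f (subspaces_between A ?W) =
      nim_sum ?f (subspaces_between A H) XOR nim_sum ?f S"
    unfolding split
    by (rule nim_sum.union_disjoint[OF finite_subspaces_between[OF fin] finS])
      (auto simp: S_def subspaces_between_def)
  also have "nim_sum ?f S =
      nim_sum (\<lambda>V. nim_sum ?f {U \<in> S. U \<inter> H = V}) (subspaces_between A H)"
    by (rule nim_sum.group[OF finS finite_subspaces_between[OF fin], symmetric])
      (use AH H in \<open>auto simp: S_def subspaces_between_def intro: seq.subspace_inter\<close>)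
  also have "\<dots> = nim_sum
      (\<lambda>V. if odd (CARD('k) ^ (seq.dim H - seq.dim V)) then c (Suc (seq.dim V)) else 0)
      (subspaces_between A H)"
  proof (rule nim_sum.cong[OF refl])
    fix V assume "V \<in> subspaces_between A H"
    then have V: "seq.subspace V" "A \<subseteq> V" "V \<subseteq> H" by (auto simp: subspaces_between_def)
    have finV: "finite V" using V fin finite_subset by blast
    let ?F = "{U \<in> S. U \<inter> H = V}"
    have "?F = {U. seq.subspace U \<and> U \<subseteq> ?W \<and> \<not> U \<subseteq> H \<and> U \<inter> H = V}"
      using V by (auto simp: S_def subspaces_between_def)
    then have "card ?F * card V = card H"
      using card_subspaces_over_hyperplane[OF fin H w V(1,3)] by simp
    then have "card ?F * CARD('k) ^ seq.dim V = CARD('k) ^ seq.dim H"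
      by (simp add: card_subspace[OF fin H] card_subspace[OF finV V(1)])
    moreover have "seq.dim V \<le> seq.dim H"
      by (rule dim_subspace_mono[OF fin V(1) H V(3)])
    ultimately have card: "card ?F = CARD('k) ^ (seq.dim H - seq.dim V)"
      using card_field_gt_1[where 'k='k]
      by (simp add: power_diff flip: \<open>card ?F * CARD('k) ^ seq.dim V = CARD('k) ^ seq.dim H\<close>)
    have "seq.dim U = Suc (seq.dim V)" if U: "U \<in> ?F" for U
    proof -
      obtain x where x: "x \<in> U" "x \<notin> H" using U by (auto simp: S_def)
      have "U = seq.span (insert x V)"
        using subspace_eq_span_insert[OF H _ _ x, of w] U
        by (auto simp: S_def subspaces_between_def)
      moreover have "x \<notin> V" using x V by blast
      ultimately show ?thesis using dim_insert_subspace[OF finV V(1)] by simp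
    qed
    then have "nim_sum ?f ?F = nim_sum (\<lambda>_. c (Suc (seq.dim V))) ?F"
      by (intro nim_sum.cong) auto
    also have "\<dots> = (if odd (card ?F) then c (Suc (seq.dim V)) else 0)"
      using finS by (intro nim_sum_constant) simp
    finally show "nim_sum ?f ?F =
        (if odd (CARD('k) ^ (seq.dim H - seq.dim V)) then c (Suc (seq.dim V)) else 0)"
      unfolding card .
  qed
  finally show ?thesis .
qed

text \<open>Climbs from \<open>A\<close> to \<open>W\<close> one dimension at a time, so that each
  step matches \<open>nim_sum_between_span_insert\<close>.\<close>

lemma subspace_interval_induct [consumes 4, case_names base step]:
  fixes A W :: "(nat \<Rightarrow> 'k::{field,finite}) set"
  assumes "finite W" "seq.subspace W" "seq.subspace A" "A \<subseteq> W"
    and base: "P A"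
    and step: "\<And>H w. finite H \<Longrightarrow> seq.subspace H \<Longrightarrow> A \<subseteq> H \<Longrightarrow> seq.dim A \<le> seq.dim H \<Longrightarrow>
      w \<notin> H \<Longrightarrow> P H \<Longrightarrow> P (seq.span (insert w H))"
  shows "P W"
  using assms(1,2,4)
proof (induction "seq.dim W" arbitrary: W)
  case 0
  then have "\<not> A \<subset> W" using dim_subspace_less[OF _ assms(3)] by fastforce
  then show ?case using 0 base by auto
next
  case (Suc d)
  show ?case
  proof (cases "A = W")
    case True
    then show ?thesis using base by simp
  next
    case False
    then have "A \<subset> W" using Suc.prems by blast
    then obtain H w where H: "seq.subspace H" "A \<subseteq> H" "H \<subset> W" "w \<notin> H"
      "W = seq.span (insert w H)" "seq.dim W = Suc (seq.dim H)"
      using hyperplane_exists[OF Suc.prems(1,2) assms(3)] by metis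
    have finH: "finite H" using H Suc.prems finite_subset by blast
    have "seq.dim A \<le> seq.dim H"
      by (rule dim_subspace_mono[OF finH assms(3) H(1,2)])
    moreover have "P H" using Suc.hyps H finH by simp
    ultimately show ?thesis using step[OF finH H(1,2)] H by simp
  qed
qed

section \<open>Interval nim-sums for even and for odd \<open>q\<close>\<close>

lemma subspaces_between_self: "seq.subspace A \<Longrightarrow> subspaces_between A A = {A}"
  by (auto simp: subspaces_between_def)

lemma nim_sum_between_even:
  fixes A W :: "(nat \<Rightarrow> 'k::{field,finite}) set"
  assumes "finite W" "seq.subspace W" "seq.subspace A" "A \<subseteq> W" and even: "even CARD('k)"
  shows "nim_sum (\<lambda>U. c (seq.dim U)) (subspaces_between A W) =
    nim_sum c {seq.dim A..seq.dim W}"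
  using assms(1-4)
proof (induction W rule: subspace_interval_induct)
  case base
  show ?case by (simp add: subspaces_between_self[OF assms(3)])
next
  case (step H w)
  let ?g = "\<lambda>V. if odd (CARD('k) ^ (seq.dim H - seq.dim V)) then c (Suc (seq.dim V)) else 0"
  have "nim_sum ?g (subspaces_between A H) = nim_sum ?g {H}"
  proof (rule nim_sum.mono_neutral_right[OF finite_subspaces_between[OF step(1)]])
    show "{H} \<subseteq> subspaces_between A H" using step by (auto simp: subspaces_between_def)
    \<comment> \<open>A proper \<open>V\<close> has smaller dimension than \<open>H\<close>, so the
      exponent is positive and the power of \<open>q\<close> even.\<close>
    show "\<forall>V\<in>subspaces_between A H - {H}. ?g V = 0"
      using dim_subspace_less[OF step(1) _ step(2)] even
      by (fastforce simp: subspaces_between_def)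
  qed
  moreover have "{seq.dim A..Suc (seq.dim H)} = insert (Suc (seq.dim H)) {seq.dim A..seq.dim H}"
    using step by auto
  ultimately show ?case
    using nim_sum_between_span_insert[OF step(1,2,5,3), of c] step
    by (simp add: dim_insert_subspace xor.commute)
qed

text \<open>Under XOR, 0, 1, 2, 3 form a Klein four-group, where two distinct nonzero elements add
  up to the third.\<close>

lemma mod_3_xor: "Suc (i mod 3) XOR Suc (Suc i mod 3) = Suc (Suc (Suc i) mod 3)"
proof -
  have "Suc 0 XOR Suc (Suc 0) = Suc (Suc (Suc 0))" "Suc (Suc 0) XOR Suc (Suc (Suc 0)) = Suc 0"
    "Suc (Suc (Suc 0)) XOR Suc 0 = Suc (Suc 0)"
    by (simp_all add: xor_nat_rec)
  moreover have "i mod 3 = 0 \<or> i mod 3 = 1 \<or> i mod 3 = 2" by presburger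
  ultimately show ?thesis
    by (elim disjE) (simp_all add: mod_Suc)
qed

text \<open>The shift \<open>r\<close> must vary in the induction: each dimension step replaces it
  by \<open>r + 2\<close>, which accumulates to \<open>2 * (seq.dim W - seq.dim A)\<close>.\<close>

lemma nim_sum_between_odd:
  fixes A W :: "(nat \<Rightarrow> 'k::{field,finite}) set"
  assumes "finite W" "seq.subspace W" "seq.subspace A" "A \<subseteq> W" and odd: "odd CARD('k)"
  shows "nim_sum (\<lambda>U. Suc ((seq.dim U + r) mod 3)) (subspaces_between A W) =
    Suc ((seq.dim A + 2 * (seq.dim W - seq.dim A) + r) mod 3)"
  using assms(1-4)
proof (induction W arbitrary: r rule: subspace_interval_induct)
  case base
  show ?case by (simp add: subspaces_between_self[OF assms(3)])
next
  case (step H w)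
  let ?c = "\<lambda>i. Suc ((i + r) mod 3)"
  have "nim_sum (\<lambda>U. ?c (seq.dim U)) (subspaces_between A (seq.span (insert w H))) =
      nim_sum (\<lambda>U. ?c (seq.dim U) XOR ?c (Suc (seq.dim U))) (subspaces_between A H)"
    using nim_sum_between_span_insert[OF step(1,2,5,3), of ?c] odd
    by (simp add: nim_sum.distrib)
  also have "\<dots> = nim_sum (\<lambda>U. Suc ((seq.dim U + (r + 2)) mod 3)) (subspaces_between A H)"
    by (simp add: mod_3_xor)
  also have "\<dots> = Suc ((seq.dim A + 2 * (seq.dim H - seq.dim A) + (r + 2)) mod 3)"
    by (rule step.IH)
  also have "\<dots> = Suc ((seq.dim A + 2 * (seq.dim (seq.span (insert w H)) - seq.dim A) + r) mod 3)"
    using step by (simp add: dim_insert_subspace Suc_diff_le)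
  finally show ?case .
qed

section \<open>The two mex computations\<close>

text \<open>This is the \<open>n\<close>-th word of the reflected binary Gray code.\<close>

definition ruler_prefix :: "nat \<Rightarrow> nat" where
  "ruler_prefix n = nim_sum (\<lambda>i. 2 ^ multiplicity 2 (i + 1)) {..<n}"

lemma ruler_prefix_0 [simp]: "ruler_prefix 0 = 0"
  by (simp add: ruler_prefix_def)

lemma ruler_prefix_Suc:
  "ruler_prefix (Suc n) = ruler_prefix n XOR 2 ^ multiplicity 2 (n + 1)"
  by (simp add: ruler_prefix_def lessThan_Suc xor.commute)

lemma multiplicity_2_double: "0 < i \<Longrightarrow> multiplicity 2 (2 * i) = Suc (multiplicity 2 (i :: nat))"
  by (rule multiplicity_times_same) auto

text \<open>Terms of even index are 1 and vanish on halving; the term of index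
  \<open>2 * m + 1\<close> becomes the one of index \<open>m\<close>.\<close>

lemma ruler_prefix_div_2: "ruler_prefix n div 2 = ruler_prefix (n div 2)"
proof (induction n)
  case (Suc n)
  show ?case
  proof (cases "even n")
    case True
    then have "multiplicity 2 (n + 1) = 0" by (intro not_dvd_imp_multiplicity_0) simp
    with True Suc show ?thesis by (simp add: ruler_prefix_Suc xor_nat_div_2)
  next
    case False
    then obtain m where m: "n = 2 * m + 1" by (rule oddE)
    then have "multiplicity 2 (n + 1) = Suc (multiplicity 2 (m + 1))"
      using multiplicity_2_double[of "m + 1"] by simp
    with m Suc show ?thesis by (simp add: ruler_prefix_Suc xor_nat_div_2)
  qed
qed simp

lemma ruler_prefix_div_power_2: "ruler_prefix n div 2 ^ v = ruler_prefix (n div 2 ^ v)"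
proof (induction v)
  case (Suc v)
  have "ruler_prefix n div 2 ^ Suc v = ruler_prefix n div 2 ^ v div 2"
    by (simp add: mult.commute flip: div_mult2_eq)
  also have "\<dots> = ruler_prefix (n div 2 ^ v div 2)" by (simp add: Suc ruler_prefix_div_2)
  also have "n div 2 ^ v div 2 = n div 2 ^ Suc v" by (simp add: mult.commute flip: div_mult2_eq)
  finally show ?case .
qed simp

lemma odd_ruler_prefix_iff: "odd (ruler_prefix n) \<longleftrightarrow> odd ((n + 1) div 2)"
proof (induction n)
  case (Suc n)
  have "odd (2 ^ multiplicity 2 (n + 1) :: nat) \<longleftrightarrow> even n"
    by (auto simp: multiplicity_eq_zero_iff)
  moreover have "odd ((n + 2) div 2) \<longleftrightarrow> (odd ((n + 1) div 2) \<noteq> even n)" by presburger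
  ultimately show ?case using Suc by (simp add: ruler_prefix_Suc even_xor_iff)
qed simp

text \<open>The halved words determine the halved indices by induction; the last bit then settles
  the parity of the index.\<close>

lemma ruler_prefix_inject: "ruler_prefix a = ruler_prefix b \<Longrightarrow> a = b"
proof (induction "a + b" arbitrary: a b rule: less_induct)
  case less
  show ?case
  proof (cases "a + b = 0")
    case False
    then have "a div 2 + b div 2 < a + b" by linarith
    moreover have "ruler_prefix (a div 2) = ruler_prefix (b div 2)"
      using less.prems by (simp flip: ruler_prefix_div_2)
    ultimately have "a div 2 = b div 2" using less.hyps by blast
    moreover have "odd ((a + 1) div 2) = odd ((b + 1) div 2)"
      using less.prems odd_ruler_prefix_iff by metis
    ultimately show ?thesis
      by (cases "even a"; cases "even b") (auto elim!: evenE oddE)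
  qed simp
qed

text \<open>
  With \<open>2\<^sup>v\<close> the largest power of two dividing \<open>d + 1\<close>, the last \<open>2\<^sup>v\<close> options are distinct and
  smaller than \<open>2\<^sup>v\<close>, hence exhaust \<open>{..<2\<^sup>v}\<close>.
\<close>

lemma mex_ruler_prefix:
  "mex ((\<lambda>k. ruler_prefix d XOR ruler_prefix k) ` {..d}) = 2 ^ multiplicity 2 (d + 1)"
proof (rule mex_eqI)
  let ?v = "multiplicity 2 (d + 1)" and ?f = "\<lambda>k. ruler_prefix d XOR ruler_prefix k"
  show "2 ^ ?v \<notin> ?f ` {..d}"
  proof
    assume "2 ^ ?v \<in> ?f ` {..d}"
    then obtain k where k: "k \<le> d" "ruler_prefix d XOR ruler_prefix k = 2 ^ ?v" by auto
    \<comment> \<open>As an option, this value would make the words at \<open>Suc d\<close> and at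
      some \<open>k \<le> d\<close> coincide.\<close>
    then have "ruler_prefix (Suc d) = ruler_prefix k"
      by (simp only: ruler_prefix_Suc flip: k(2)) simp
    then show False using ruler_prefix_inject k by fastforce
  qed
  have "2 ^ ?v dvd d + 1" by (rule multiplicity_dvd)
  then obtain m where m: "d + 1 = 2 ^ ?v * m" by (rule dvdE)
  then have "m \<noteq> 0" by (intro notI) simp
  then obtain m' where m': "m = Suc m'" by (cases m) auto
  \<comment> \<open>The aligned block of \<open>2 ^ ?v\<close> indices ending at \<open>d\<close>.
    Its members share the quotient \<open>m'\<close>, so their words agree above the lowest
    \<open>?v\<close> bits.\<close>
  let ?K = "{2 ^ ?v * m'..<2 ^ ?v * m}"
  have "?f ` ?K \<subseteq> {..<2 ^ ?v}"
  proof (rule image_subsetI, simp only: lessThan_iff)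
    fix k assume k: "k \<in> ?K"
    have div: "j div 2 ^ ?v = m'" if "j \<in> ?K" for j
      using that by (intro div_nat_eqI) (auto simp: m' mult.commute)
    have "2 ^ ?v * m' < 2 ^ ?v * m" using m' by simp
    then have "d \<in> ?K" unfolding m[symmetric] by simp
    then have "?f k div 2 ^ ?v = 0"
      using div[OF k] div[of d] by (simp add: xor_nat_div_power_2 ruler_prefix_div_power_2)
    then show "?f k < 2 ^ ?v" by (simp add: div_eq_0_iff)
  qed
  moreover have "inj_on ?f ?K"
    by (rule inj_onI) (metis xor_nat_left_self ruler_prefix_inject)
  then have "card (?f ` ?K) = card {..<2 ^ ?v :: nat}" by (simp add: card_image m')
  ultimately have "?f ` ?K = {..<2 ^ ?v}" by (intro card_subset_eq) auto
  moreover have "?K \<subseteq> {..d}" using m by auto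
  ultimately show "y \<in> ?f ` {..d}" if "y < 2 ^ ?v" for y using that by blast
qed

lemma nim_sum_atLeastAtMost_ruler:
  assumes "k \<le> d"
  shows "nim_sum (\<lambda>i. 2 ^ multiplicity 2 (i + 1)) {k..d} = ruler_prefix (Suc d) XOR ruler_prefix k"
proof -
  have *: "{..<Suc d} = {..<k} \<union> {k..d}" using assms by auto
  have "ruler_prefix (Suc d) =
      ruler_prefix k XOR nim_sum (\<lambda>i. 2 ^ multiplicity 2 (i + 1)) {k..d}"
    unfolding ruler_prefix_def * by (rule nim_sum.union_disjoint) auto
  then have "nim_sum (\<lambda>i. 2 ^ multiplicity 2 (i + 1)) {k..d} =
      ruler_prefix k XOR ruler_prefix (Suc d)"
    by (simp only: xor_nat_left_self)
  then show ?thesis by (simp only: xor.commute)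
qed

text \<open>\<open>Suc (d mod 3)\<close> is no option because the other summand is nonzero; the
  indices \<open>d\<close>, \<open>d - 1\<close>, \<open>d - 2\<close> supply all smaller
  values.\<close>

lemma mex_mod_3:
  "mex ((\<lambda>k. Suc ((k + 2 * (d - k)) mod 3) XOR Suc (d mod 3)) ` {..d}) = Suc (d mod 3)"
proof (rule mex_eqI)
  let ?f = "\<lambda>k. Suc ((k + 2 * (d - k)) mod 3) XOR Suc (d mod 3)"
  show "Suc (d mod 3) \<notin> ?f ` {..d}"
  proof
    assume "Suc (d mod 3) \<in> ?f ` {..d}"
    then obtain k where "Suc (d mod 3) = ?f k" by blast
    then have "Suc ((k + 2 * (d - k)) mod 3) = 0" by (metis xor_nat_right_self xor_self_eq)
    then show False by simp
  qed
  fix y assume y: "y < Suc (d mod 3)"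
  have d: "d mod 3 = 0 \<or> d mod 3 = 1 \<or> d mod 3 = 2" by presburger
  have 0: "?f d = 0" by simp
  have 1: "?f (d - 1) = Suc ((d + 2) mod 3)" if "1 \<le> d"
  proof -
    have "d - 1 + 2 * (d - (d - 1)) = Suc d" using that by simp
    then show ?thesis using mod_3_xor[of d] by (simp only: xor.commute) simp
  qed
  have 2: "?f (d - 2) = Suc ((d + 1) mod 3)" if "2 \<le> d"
  proof -
    have "d - 2 + 2 * (d - (d - 2)) = Suc (Suc d)" using that by simp
    then show ?thesis using mod_3_xor[of d]
      by (metis add.commute plus_1_eq_Suc xor.commute xor_nat_left_self)
  qed
  have "\<exists>k\<le>d. ?f k = y"
  proof -
    consider "y = 0" | "y = 1" "1 \<le> d mod 3" | "y = 2" "d mod 3 = 2" using y d by linarith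
    then show ?thesis
    proof cases
      case 1
      then show ?thesis using 0 by blast
    next
      \<comment> \<open>The value 1 comes from \<open>d - 1\<close> if \<open>d mod 3 = 1\<close>
        and from \<open>d - 2\<close> if \<open>d mod 3 = 2\<close>; these residues also keep the
        subtraction from being truncated.\<close>
      case y: 2
      show ?thesis
      proof (cases "d mod 3 = 1")
        case True
        then have "1 \<le> d" "Suc ((d + 2) mod 3) = y" using y by presburger+
        with 1 show ?thesis by (metis diff_le_self)
      next
        case False
        then have "2 \<le> d" "Suc ((d + 1) mod 3) = y" using y d by presburger+
        with 2 show ?thesis by (metis diff_le_self)
      qed
    next
      case y: 3
      then have "1 \<le> d" "Suc ((d + 2) mod 3) = y" using d by presburger+
      with 1 show ?thesis by (metis diff_le_self)
    qed
  qed
  then show "y \<in> ?f ` {..d}" by blast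
qed

section \<open>The ruler game on subspaces\<close>

lemma finite_coord_space: "finite (coord_space n :: (nat \<Rightarrow> 'k::{field,finite}) set)"
  by (rule finite_subset[OF _ finite_set_of_finite_funs[of "{..<n}" UNIV 0]])
    (auto simp: coord_space_def)

text \<open>XORing with \<open>c (seq.dim W)\<close> removes the top from the interval, so
  \<open>s k d\<close> is the option given by an interval from dimension \<open>k\<close> to
  dimension \<open>d\<close>. As it depends on dimensions alone, the recursion becomes a mex over
  \<open>k \<le> d\<close>.\<close>

lemma ruler_grundy_subspaces:
  fixes W :: "(nat \<Rightarrow> 'k::{field,finite}) set"
  assumes N: "\<And>A W :: (nat \<Rightarrow> 'k) set. \<lbrakk>finite W; seq.subspace W; seq.subspace A; A \<subseteq> W\<rbrakk> \<Longrightarrow>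
      nim_sum (\<lambda>U. c (seq.dim U)) (subspaces_between A W) XOR c (seq.dim W) =
        s (seq.dim A) (seq.dim W)"
    and mex: "\<And>d. mex ((\<lambda>k. s k d) ` {..d}) = c d"
    and "W \<in> subspaces n"
  shows "ruler_grundy (subspaces n) W = c (seq.dim W)"
proof -
  let ?X = "subspaces n :: (nat \<Rightarrow> 'k) set set"
  let ?f = "\<lambda>U :: (nat \<Rightarrow> 'k) set. c (seq.dim U)"
  have "sprague_grundy (coin_moves ?X (closed_intervals ?X)) {W} = nim_sum ?f {W}"
  proof (rule sprague_grundy_coin_moves[OF finite_subspaces])
    show "T \<subseteq> ?X" if "T \<in> closed_intervals ?X" for T
      using that by (auto simp: closed_intervals_def)
    show "{W} \<subseteq> ?X" using assms(3) by simp
    fix V assume V: "V \<in> ?X"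
    then have sV: "seq.subspace V" by (simp add: subspaces_def)
    have "V \<subseteq> coord_space n" using V by (simp add: subspaces_def)
    then have finV: "finite V" by (rule finite_subset[OF _ finite_coord_space])
    have int: "{U \<in> ?X. A \<subseteq> U \<and> U \<subseteq> V} = subspaces_between A V" for A
      using V by (auto simp: subspaces_def subspaces_between_def)
    have val: "nim_sum ?f (subspaces_between A V - {V}) = s (seq.dim A) (seq.dim V)"
      if A: "seq.subspace A" "A \<subseteq> V" for A
    proof -
      have "V \<in> subspaces_between A V" using A sV by (simp add: subspaces_between_def)
      then have "nim_sum ?f (subspaces_between A V) =
          c (seq.dim V) XOR nim_sum ?f (subspaces_between A V - {V})"
        by (rule nim_sum.remove[OF finite_subspaces_between[OF finV]])
      then show ?thesis using N[OF finV sV A] by (simp add: ac_simps)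
    qed
    have "{nim_sum ?f (T - {V}) | T. T \<in> closed_intervals ?X \<and> V \<in> T \<and> (\<forall>t\<in>T. t \<le> V)} =
        {nim_sum ?f (subspaces_between A V - {V}) | A. seq.subspace A \<and> A \<subseteq> V}" (is "?L = ?R")
    proof (intro equalityI subsetI)
      fix y assume "y \<in> ?L"
      then obtain A B where AB: "A \<in> ?X" "B \<in> ?X" "A \<subseteq> B"
        and T: "V \<in> {U \<in> ?X. A \<subseteq> U \<and> U \<subseteq> B}" "\<forall>t\<in>{U \<in> ?X. A \<subseteq> U \<and> U \<subseteq> B}. t \<subseteq> V"
        and y: "y = nim_sum ?f ({U \<in> ?X. A \<subseteq> U \<and> U \<subseteq> B} - {V})"
        by (auto simp: closed_intervals_def)
      \<comment> \<open>\<open>B\<close> belongs to its own interval, whose maximum is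
        \<open>V\<close>.\<close>
      have "B = V" using AB T by blast
      then have "y = nim_sum ?f (subspaces_between A V - {V})" using y int by simp
      moreover have "seq.subspace A" "A \<subseteq> V" using AB \<open>B = V\<close> by (auto simp: subspaces_def)
      ultimately show "y \<in> ?R" by blast
    next
      fix y assume "y \<in> ?R"
      then obtain A where A: "seq.subspace A" "A \<subseteq> V"
        and y: "y = nim_sum ?f (subspaces_between A V - {V})" by blast
      have "A \<in> ?X" using A V by (auto simp: subspaces_def)
      then have "subspaces_between A V \<in> closed_intervals ?X"
        unfolding closed_intervals_def int[symmetric] using A V by blast
      moreover have "V \<in> subspaces_between A V" "\<forall>t\<in>subspaces_between A V. t \<le> V"
        using A sV by (auto simp: subspaces_between_def)
      ultimately show "y \<in> ?L" using y by blast
    qed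
    also have "\<dots> = (\<lambda>A. s (seq.dim A) (seq.dim V)) ` {A. seq.subspace A \<and> A \<subseteq> V}"
      unfolding setcompr_eq_image by (rule image_cong) (auto simp: val)
    also have "\<dots> = (\<lambda>k. s k (seq.dim V)) ` seq.dim ` {A. seq.subspace A \<and> A \<subseteq> V}"
      by (simp add: image_image)
    also have "seq.dim ` {A. seq.subspace A \<and> A \<subseteq> V} = {..seq.dim V}"
    proof (intro equalityI subsetI)
      fix k assume "k \<in> seq.dim ` {A. seq.subspace A \<and> A \<subseteq> V}"
      then obtain A where A: "seq.subspace A" "A \<subseteq> V" "k = seq.dim A" by blast
      then show "k \<in> {..seq.dim V}"
        using dim_subspace_mono[OF finV A(1) sV] by simp
    next
      fix k assume "k \<in> {..seq.dim V}"
      then show "k \<in> seq.dim ` {A. seq.subspace A \<and> A \<subseteq> V}"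
        using subspace_of_dim_exists[OF finV sV, of k] by auto
    qed
    finally show "?f V = mex {nim_sum ?f (T - {V}) | T.
        T \<in> closed_intervals ?X \<and> V \<in> T \<and> (\<forall>t\<in>T. t \<le> V)}"
      by (simp only: mex)
  qed
  then show ?thesis by (simp add: ruler_grundy_def coin_grundy_def)
qed

section \<open>Grundy values for the two parities of \<open>q\<close>\<close>

lemma ruler_grundy_subspaces_even:
  fixes W :: "(nat \<Rightarrow> 'k::{field,finite}) set"
  assumes even: "even CARD('k)" and "W \<in> subspaces n"
  shows "ruler_grundy (subspaces n) W = 2 ^ multiplicity 2 (seq.dim W + 1)"
proof (rule ruler_grundy_subspaces[where s = "\<lambda>k d. ruler_prefix d XOR ruler_prefix k"])
  fix A W :: "(nat \<Rightarrow> 'k) set"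
  assume AW: "finite W" "seq.subspace W" "seq.subspace A" "A \<subseteq> W"
  then have "seq.dim A \<le> seq.dim W"
    by (intro dim_subspace_mono)
  \<comment> \<open>The top term turns \<open>ruler_prefix (Suc (seq.dim W))\<close> into
    \<open>ruler_prefix (seq.dim W)\<close>, whence the choice of \<open>s\<close>.\<close>
  then show "nim_sum (\<lambda>U. 2 ^ multiplicity 2 (seq.dim U + 1)) (subspaces_between A W) XOR
      2 ^ multiplicity 2 (seq.dim W + 1) = ruler_prefix (seq.dim W) XOR ruler_prefix (seq.dim A)"
    using nim_sum_between_even[OF AW even, of "\<lambda>i. 2 ^ multiplicity 2 (i + 1)"]
    by (simp only: nim_sum_atLeastAtMost_ruler ruler_prefix_Suc) (simp add: ac_simps)
qed (use mex_ruler_prefix assms(2) in auto)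

lemma ruler_grundy_subspaces_odd:
  fixes W :: "(nat \<Rightarrow> 'k::{field,finite}) set"
  assumes odd: "odd CARD('k)" and "W \<in> subspaces n"
  shows "ruler_grundy (subspaces n) W = Suc (seq.dim W mod 3)"
proof (rule ruler_grundy_subspaces
    [where s = "\<lambda>k d. Suc ((k + 2 * (d - k)) mod 3) XOR Suc (d mod 3)"])
  fix A W :: "(nat \<Rightarrow> 'k) set"
  assume AW: "finite W" "seq.subspace W" "seq.subspace A" "A \<subseteq> W"
  show "nim_sum (\<lambda>U. Suc (seq.dim U mod 3)) (subspaces_between A W) XOR Suc (seq.dim W mod 3) =
      Suc ((seq.dim A + 2 * (seq.dim W - seq.dim A)) mod 3) XOR Suc (seq.dim W mod 3)"
    using nim_sum_between_odd[OF AW odd, of 0] by simp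
qed (use mex_mod_3 assms(2) in auto)

theorem mainTheorem3:
  fixes n q :: nat
  assumes "primepow q" and "CARD('k::{field,finite}) = q"
  shows "(\<forall>W \<in> subspaces n.
            ruler_grundy (subspaces n) (W :: (nat \<Rightarrow> 'k) set) = g_q TYPE('k) (seq.dim W)) \<and>
         (even q \<longrightarrow> (\<forall>d. g_q TYPE('k) d = 2 ^ multiplicity 2 (d + 1))) \<and>
         (odd q \<longrightarrow> (\<forall>d. g_q TYPE('k) d = d mod 3 + 1))"
proof (cases "even q")
  case True
  \<comment> \<open>A free \<open>m\<close> covers both \<open>W\<close> in
    \<open>subspaces n\<close> and the full space in \<open>subspaces d\<close> that defines
    \<open>g_q\<close>.\<close>
  then have g: "ruler_grundy (subspaces m) W = 2 ^ multiplicity 2 (seq.dim W + 1)"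
    if "W \<in> subspaces m" for m and W :: "(nat \<Rightarrow> 'k) set"
    using ruler_grundy_subspaces_even that assms(2) by blast
  then have "g_q TYPE('k) d = 2 ^ multiplicity 2 (d + 1)" for d
    unfolding g_q_def by (simp only: g[OF coord_space_in_subspaces] dim_coord_space)
  with g True show ?thesis by simp
next
  case False
  then have g: "ruler_grundy (subspaces m) W = Suc (seq.dim W mod 3)"
    if "W \<in> subspaces m" for m and W :: "(nat \<Rightarrow> 'k) set"
    using ruler_grundy_subspaces_odd that assms(2) by blast
  then have "g_q TYPE('k) d = Suc (d mod 3)" for d
    unfolding g_q_def by (simp only: g[OF coord_space_in_subspaces] dim_coord_space)
  with g False show ?thesis by simp
qed

end
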